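(* Let $k:\mathbb{X}\times\Theta\to\mathbb{R}^+$ be a measurable function such that, for every fixed $\vartheta\in\Theta$, $x\mapsto k(x,\vartheta)$ is a density with respect to a $\sigma$-finite measure $\lambda$ on $\mathbb{X}$. Let $\{Q_n,n\ge1\}$ be the measure-valued Markov chain on $\Theta$ defined by $$Q_n=W_n\delta_{\vartheta_n}+(1-W_n)Q_{n-1},\qquad n\ge1,$$ let $Q$ be the random probability measure on $\Theta$ that is the a.s. weak limit of $Q_n$, and set $$f_n^{(Q)}(x)=\int_\Theta k(x,\vartheta)\,Q_n(\mathrm{d}\vartheta),\qquad f^{(Q)}(x)=\int_\Theta k(x,\vartheta)\,Q(\mathrm{d}\vartheta),\qquad x\in\mathbb{X}.$$ If $\vartheta\mapsto k(x,\vartheta)$ is continuous for all $x\in\mathbb{X}$ and bounded by $h(x)$ (that is, $k(x,\vartheta)\le h(x)$ for all $x\in\mathbb{X}$, $\vartheta\in\Theta$), where $h$ is a $\lambda$-integrable function on $\mathbb{X}$, then $$\lim_{n\to+\infty}\int_{\mathbb{X}}\bigl|f_n^{(Q)}(x)-f^{(Q)}(x)\bigr|\,\lambda(\mathrm{d}x)=0\qquad\text{a.s.-}\mathbb{P}.$$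
   Context: $\mathbb{X}$ and $\Theta$ are Polish spaces with their Borel $\sigma$-fields; all random elements are defined on a probability space $(\Omega,\mathscr{F},\mathbb{P})$. $\{W_n,n\ge1\}$ is a sequence of independent random variables with $W_1=1$ almost surely and $W_n$ having Beta distribution with parameter $(1,n-1)$ for $n\ge2$. $\{\vartheta_n,n\ge1\}$ is an exchangeable sequence of $\Theta$-valued random variables, independent of $\{W_n,n\ge1\}$. Since $W_1=1$ a.s., the choice of $Q_0$ is irrelevant. For such a chain there exists a random probability measure $Q$ on $\Theta$, whose law is the de Finetti measure of $\{\vartheta_n\}$, such that for $\mathbb{P}$-almost every $\omega$ the measures $Q_n(\omega)$ converge weakly to $Q(\omega)$ as $n\to+\infty$; this is the $Q$ in the statement. *)

theory Defs
  imports "HOL-Probability.Probability"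
begin

definition beta_density :: "real \<Rightarrow> real \<Rightarrow> real \<Rightarrow> real" where
  "beta_density a b x =
     (if 0 < x \<and> x < 1 then x powr (a - 1) * (1 - x) powr (b - 1) / Beta a b else 0)"

text \<open>
  The library's \<open>indep_var\<close> forces both random variables to have the same value type; this is
  the condition of \<open>indep_var_eq\<close> with distinct value types.
\<close>

definition (in prob_space) indep_rvs ::
    "'b measure \<Rightarrow> ('a \<Rightarrow> 'b) \<Rightarrow> 'c measure \<Rightarrow> ('a \<Rightarrow> 'c) \<Rightarrow> bool" where
  "indep_rvs S X T Y \<longleftrightarrow>
     random_variable S X \<and> random_variable T Y \<and>
     indep_set
       (sigma_sets (space M) {X -` A \<inter> space M | A. A \<in> sets S})
       (sigma_sets (space M) {Y -` A \<inter> space M | A. A \<in> sets T})"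

lemma (in prob_space) indep_rvs_iff_indep_var: "indep_rvs S X T Y \<longleftrightarrow> indep_var S X T Y"
  by (simp add: indep_rvs_def indep_var_eq)

text \<open>Sequences are indexed by the positive integers; index 0 plays no role.\<close>

definition exchangeable :: "'w measure \<Rightarrow> 'a measure \<Rightarrow> (nat \<Rightarrow> 'w \<Rightarrow> 'a) \<Rightarrow> bool" where
  "exchangeable M N X \<longleftrightarrow>
     (\<forall>n p. p permutes {1..n} \<longrightarrow>
        distr M (\<Pi>\<^sub>M i\<in>{1..n}. N) (\<lambda>\<omega>. \<lambda>i\<in>{1..n}. X (p i) \<omega>) =
        distr M (\<Pi>\<^sub>M i\<in>{1..n}. N) (\<lambda>\<omega>. \<lambda>i\<in>{1..n}. X i \<omega>))"

text \<open>
  The library's \<open>weak_conv_m\<close> is phrased through distribution functions and so is limited to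
  measures on the real line; this is weak convergence on a general topological space.
\<close>

definition weakly_converges ::
    "(nat \<Rightarrow> 'a::topological_space measure) \<Rightarrow> 'a measure \<Rightarrow> bool" where
  "weakly_converges \<mu> \<nu> \<longleftrightarrow>
     (\<forall>g :: 'a \<Rightarrow> real. continuous_on UNIV g \<longrightarrow> bounded (range g) \<longrightarrow>
        (\<lambda>n. LINT x|\<mu> n. g x) \<longlonglongrightarrow> (LINT x|\<nu>. g x))"

text \<open>
  The measure \<open>w M + (1 - w) N\<close>, for \<open>w\<close> in the unit interval and measures with the same
  \<open>\<sigma>\<close>-algebra. (Outside the unit interval \<open>ennreal\<close> truncates the negative coefficient to 0.)
\<close>

definition mix_measure :: "real \<Rightarrow> 'a measure \<Rightarrow> 'a measure \<Rightarrow> 'a measure" where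
  "mix_measure w M N = measure_of (space M) (sets M)
     (\<lambda>A. ennreal w * emeasure M A + ennreal (1 - w) * emeasure N A)"

lemma space_mix_measure [simp]: "space (mix_measure w M N) = space M"
  and sets_mix_measure [simp]: "sets (mix_measure w M N) = sets M"
  by (simp_all add: mix_measure_def)

lemma emeasure_mix_measure:
  assumes "sets N = sets M" "A \<in> sets M"
  shows "emeasure (mix_measure w M N) A =
    ennreal w * emeasure M A + ennreal (1 - w) * emeasure N A"
proof -
  have "countably_additive (sets M)
    (\<lambda>A. ennreal w * emeasure M A + ennreal (1 - w) * emeasure N A)"
    unfolding countably_additive_def
    using assms(1) by (auto simp: suminf_add[symmetric] suminf_emeasure)
  then show ?thesis
    unfolding mix_measure_def using assms(2)
    by (intro emeasure_measure_of_sigma)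
       (auto simp: positive_def sets.sigma_algebra_axioms)
qed

primrec measure_chain ::
    "('w \<Rightarrow> 'a::topological_space measure) \<Rightarrow> (nat \<Rightarrow> 'w \<Rightarrow> real) \<Rightarrow> (nat \<Rightarrow> 'w \<Rightarrow> 'a) \<Rightarrow>
     nat \<Rightarrow> 'w \<Rightarrow> 'a measure" where
  "measure_chain Q0 W \<theta> 0 \<omega> = Q0 \<omega>"
| "measure_chain Q0 W \<theta> (Suc n) \<omega> =
     mix_measure (W (Suc n) \<omega>) (return borel (\<theta> (Suc n) \<omega>)) (measure_chain Q0 W \<theta> n \<omega>)"

definition mixture_density ::
    "('x \<Rightarrow> 'a \<Rightarrow> real) \<Rightarrow> 'a measure \<Rightarrow> 'x \<Rightarrow> real" where
  "mixture_density k \<mu> x = (LINT \<theta>|\<mu>. k x \<theta>)"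

end

theory Submission
  imports Defs
begin

text \<open>
  Weak convergence applied to the bounded continuous function \<open>k x\<close> gives pointwise convergence of
  the mixture densities. Almost surely all weights lie in the unit interval, so the chain consists of
  probability measures and all these densities lie between 0 and \<open>h\<close>; convergence in \<open>L\<^sup>1\<close>
  follows by dominated convergence.
\<close>

text \<open>The law of \<open>X\<close> has a density that vanishes off the open unit interval, so
  the complement of that interval carries no mass. This confines the random weights to the range
  where \<open>mix_measure\<close> is a genuine convex combination.\<close>

lemma beta_distributed_AE:
  assumes "distributed M lborel X (beta_density a b)"
  shows "AE \<omega> in M. 0 < X \<omega> \<and> X \<omega> < 1"
proof -
  have X: "X \<in> measurable M lborel"
    and d: "(\<lambda>x. ennreal (beta_density a b x)) \<in> borel_measurable lborel"
    and eq: "distr M lborel X = density lborel (\<lambda>x. ennreal (beta_density a b x))"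
    using assms by (auto simp: distributed_def)
  have "AE x in distr M lborel X. 0 < x \<and> x < 1"
    unfolding eq by (subst AE_density[OF d]) (auto simp: beta_density_def)
  from AE_distrD[OF X this] show ?thesis .
qed

lemma prob_space_mix_measure:
  assumes "prob_space M" "prob_space N" "sets N = sets M" "0 \<le> w" "w \<le> 1"
  shows "prob_space (mix_measure w M N)"
proof
  have "emeasure N (space M) = 1"
    using assms(2) sets_eq_imp_space_eq[OF assms(3)] by (metis prob_space.emeasure_space_1)
  then have "emeasure (mix_measure w M N) (space M) = ennreal w + ennreal (1 - w)"
    using assms(1,3) by (simp add: emeasure_mix_measure prob_space.emeasure_space_1)
  \<comment> \<open>Both coefficients are nonnegative, so \<open>ennreal\<close> truncates neither
    and they add up inside a single \<open>ennreal\<close>.\<close>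
  also have "\<dots> = 1"
    using assms(4,5) by (simp flip: ennreal_plus)
  finally show "emeasure (mix_measure w M N) (space (mix_measure w M N)) = 1" by simp
qed

text \<open>Pathwise, for one fixed \<open>\<omega>\<close>: convex combinations preserve total mass
  1. The weights are constrained only from index 1 on, since the step to \<open>Suc n\<close> uses
  \<open>W (Suc n)\<close>; the sigma-algebra is inherited from the Dirac measure.\<close>

lemma measure_chain_prob:
  assumes "prob_space (Q0 \<omega>)" "sets (Q0 \<omega>) = sets borel"
    and "\<And>n. n \<ge> 1 \<Longrightarrow> 0 \<le> W n \<omega> \<and> W n \<omega> \<le> 1"
  shows "prob_space (measure_chain Q0 W \<theta> n \<omega>) \<and> sets (measure_chain Q0 W \<theta> n \<omega>) = sets borel"
proof (induction n)
  case 0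
  then show ?case using assms by simp
next
  case (Suc n)
  from Suc.IH have "prob_space (measure_chain Q0 W \<theta> (Suc n) \<omega>)"
    unfolding measure_chain.simps
    using assms(3)[of "Suc n"] by (intro prob_space_mix_measure prob_space_return) simp_all
  then show ?case by simp
qed

lemma mixture_density_bounds:
  assumes "prob_space \<mu>" "sets \<mu> = sets borel"
    and "k x \<in> borel_measurable borel" "\<And>t. 0 \<le> k x t" "\<And>t. k x t \<le> c"
  shows "0 \<le> mixture_density k \<mu> x" "mixture_density k \<mu> x \<le> c"
proof -
  interpret prob_space \<mu> by fact
  have "k x \<in> borel_measurable \<mu>"
    using assms(3) by (simp add: measurable_cong_sets[OF assms(2) refl])
  then have "integrable \<mu> (k x)"
    using assms(4,5) by (intro integrable_const_bound[where B = c]) auto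
  then show "mixture_density k \<mu> x \<le> c"
    unfolding mixture_density_def using assms(5) by (intro integral_le_const) auto
  show "0 \<le> mixture_density k \<mu> x"
    unfolding mixture_density_def using assms(4) by simp
qed

text \<open>This is the measurability half of Fubini's theorem: integrating out one variable of a
  jointly measurable function leaves a measurable function of the other.\<close>

lemma borel_measurable_mixture_density:
  assumes "sigma_finite_measure \<mu>" "sets \<mu> = sets borel" "sets L = sets borel"
    and "(\<lambda>(x, t). k x t) \<in> borel_measurable (borel \<Otimes>\<^sub>M borel)"
  shows "mixture_density k \<mu> \<in> borel_measurable L"
proof -
  interpret sigma_finite_measure \<mu> by fact
  have pair: "sets (L \<Otimes>\<^sub>M \<mu>) = sets (borel \<Otimes>\<^sub>M borel)"
    using assms(2,3) by (intro sets_pair_measure_cong)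
  have "(\<lambda>(x, t). k x t) \<in> borel_measurable (L \<Otimes>\<^sub>M \<mu>)"
    using assms(4) by (simp add: measurable_cong_sets[OF pair refl])
  then show ?thesis
    unfolding mixture_density_def[abs_def] by (rule borel_measurable_lebesgue_integral)
qed

text \<open>The deterministic core. A single weak limit yields convergence at every \<open>x\<close>
  simultaneously, so in the application the exceptional event cannot depend on
  \<open>x\<close>.\<close>

lemma mixture_density_L1_convergence:
  fixes k :: "'x::polish_space \<Rightarrow> 'a::polish_space \<Rightarrow> real"
  assumes weak: "weakly_converges \<mu> \<nu>"
    and \<mu>: "\<And>n. prob_space (\<mu> n)" "\<And>n. sets (\<mu> n) = sets borel"
    and \<nu>: "prob_space \<nu>" "sets \<nu> = sets borel"
    and L: "sets L = sets borel"
    and k_meas: "(\<lambda>(x, t). k x t) \<in> borel_measurable (borel \<Otimes>\<^sub>M borel)"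
    and k_nonneg: "\<And>x t. 0 \<le> k x t"
    and k_cont: "\<And>x. continuous_on UNIV (k x)"
    and k_le_h: "\<And>x t. k x t \<le> h x"
    and h: "integrable L h"
  shows "(\<lambda>n. \<integral>\<^sup>+ x. ennreal \<bar>mixture_density k (\<mu> n) x - mixture_density k \<nu> x\<bar> \<partial>L)
    \<longlonglongrightarrow> 0"
proof -
  have km: "k x \<in> borel_measurable borel" for x
    using k_cont by (rule borel_measurable_continuous_onI)
  \<comment> \<open>Squeeze through \<open>k x t\<close> at an arbitrary \<open>t\<close>.\<close>
  have h_nonneg: "0 \<le> h x" for x
    using order_trans[OF k_nonneg k_le_h] .
  \<comment> \<open>Both mixtures lie between 0 and \<open>h x\<close>, so their distance is at most
    \<open>h x\<close> itself, not merely twice it.\<close>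
  have dom: "\<bar>mixture_density k (\<mu> n) x - mixture_density k \<nu> x\<bar> \<le> h x" for n x
    using mixture_density_bounds[where k = k and x = x and c = "h x",
        OF \<mu>(1)[of n] \<mu>(2) km k_nonneg k_le_h]
      mixture_density_bounds[where k = k and x = x and c = "h x",
        OF \<nu> km k_nonneg k_le_h] by linarith
  have meas[measurable]: "mixture_density k (\<mu> n) \<in> borel_measurable L"
      "mixture_density k \<nu> \<in> borel_measurable L" for n
    using \<mu> \<nu> L k_meas
    by (intro borel_measurable_mixture_density prob_space_imp_sigma_finite; simp)+
  have lim: "(\<lambda>n. mixture_density k (\<mu> n) x) \<longlonglongrightarrow> mixture_density k \<nu> x" for x
  proof -
    \<comment> \<open>With continuity, this makes \<open>k x\<close> an admissible test function for
      weak convergence.\<close>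
    have "bounded (range (k x))"
      using k_nonneg k_le_h by (intro boundedI[where B = "h x"]) auto
    then show ?thesis
      using weak k_cont unfolding weakly_converges_def mixture_density_def by blast
  qed
  have "(\<lambda>n. \<integral>\<^sup>+ x. ennreal \<bar>mixture_density k (\<mu> n) x - mixture_density k \<nu> x\<bar> \<partial>L)
      \<longlonglongrightarrow> (\<integral>\<^sup>+ x. 0 \<partial>L)"
  proof (rule nn_integral_dominated_convergence[where w = "\<lambda>x. ennreal (h x)"])
    show "(\<integral>\<^sup>+ x. ennreal (h x) \<partial>L) < \<infinity>"
      using h h_nonneg by (simp add: nn_integral_eq_integral)
    have "(\<lambda>n. ennreal \<bar>mixture_density k (\<mu> n) x - mixture_density k \<nu> x\<bar>) \<longlonglongrightarrow> 0" for x
    proof -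
      have "(\<lambda>n. \<bar>mixture_density k (\<mu> n) x - mixture_density k \<nu> x\<bar>) \<longlonglongrightarrow> 0"
        using lim[of x] by (intro tendsto_rabs_zero LIM_zero)
      from tendsto_ennrealI[OF this] show ?thesis by simp
    qed
    then show "AE x in L. (\<lambda>n. ennreal \<bar>mixture_density k (\<mu> n) x - mixture_density k \<nu> x\<bar>)
      \<longlonglongrightarrow> 0" by simp
  qed (use h dom in \<open>auto intro: ennreal_leI\<close>)
  then show ?thesis by simp
qed

theorem theorem2:
  fixes M :: "'w measure"
    and W :: "nat \<Rightarrow> 'w \<Rightarrow> real"
    and \<theta> :: "nat \<Rightarrow> 'w \<Rightarrow> 'a::polish_space"
    and Q0 Q :: "'w \<Rightarrow> 'a measure"
    and L :: "'x::polish_space measure"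
    and k :: "'x \<Rightarrow> 'a \<Rightarrow> real"
    and h :: "'x \<Rightarrow> real"
  assumes "prob_space M"
    and W_indep: "prob_space.indep_vars M (\<lambda>_. borel) W {1..}"
    and W_1: "AE \<omega> in M. W 1 \<omega> = 1"
    and W_beta: "\<And>n. n \<ge> 2 \<Longrightarrow> distributed M lborel (W n) (beta_density 1 (real n - 1))"
    and \<theta>_meas: "\<And>n. n \<ge> 1 \<Longrightarrow> \<theta> n \<in> measurable M borel"
    and \<theta>_exch: "exchangeable M borel \<theta>"
    and W_\<theta>_indep: "prob_space.indep_rvs M
          (\<Pi>\<^sub>M n\<in>{1..}. borel) (\<lambda>\<omega>. \<lambda>n\<in>{1..}. W n \<omega>)
          (\<Pi>\<^sub>M n\<in>{1..}. borel) (\<lambda>\<omega>. \<lambda>n\<in>{1..}. \<theta> n \<omega>)"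
    and Q0_meas: "Q0 \<in> measurable M (prob_algebra borel)"
    and Q_meas: "Q \<in> measurable M (prob_algebra borel)"
    and Q_limit: "AE \<omega> in M. weakly_converges (\<lambda>n. measure_chain Q0 W \<theta> n \<omega>) (Q \<omega>)"
    and L_borel: "sets L = sets borel"
    and L_sigma_finite: "sigma_finite_measure L"
    and k_meas: "(\<lambda>(x, t). k x t) \<in> borel_measurable (borel \<Otimes>\<^sub>M borel)"
    and k_nonneg: "\<And>x t. 0 \<le> k x t"
    and k_density: "\<And>t. prob_space (density L (\<lambda>x. ennreal (k x t)))"
    and k_cont: "\<And>x. continuous_on UNIV (\<lambda>t. k x t)"
    and k_le_h: "\<And>x t. k x t \<le> h x"
    and h_integrable: "integrable L h"
  shows "AE \<omega> in M.
    (\<lambda>n. \<integral>\<^sup>+ x. ennreal \<bar>mixture_density k (measure_chain Q0 W \<theta> n \<omega>) x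
                      - mixture_density k (Q \<omega>) x\<bar> \<partial>L) \<longlonglongrightarrow> 0"
proof -
  have "AE \<omega> in M. 0 \<le> W n \<omega> \<and> W n \<omega> \<le> 1" if "n \<ge> 1" for n
  \<comment> \<open>The first weight is a point mass at 1 and is treated apart; the Beta densities
    start at index 2.\<close>
  proof (cases "n = 1")
    case True
    then show ?thesis using W_1 by auto
  next
    case False
    then have "n \<ge> 2" using that by simp
    from beta_distributed_AE[OF W_beta[OF this]] show ?thesis by eventually_elim auto
  qed
  \<comment> \<open>Countably many null sets are merged into one that serves all
    \<open>n\<close>.\<close>
  then have W_unit: "AE \<omega> in M. \<forall>n. n \<ge> 1 \<longrightarrow> 0 \<le> W n \<omega> \<and> W n \<omega> \<le> 1"
    by (simp add: AE_all_countable)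
  show ?thesis
    using AE_space W_unit Q_limit
  proof eventually_elim
    case (elim \<omega>)
    \<comment> \<open>As \<open>\<omega>\<close> lies in \<open>space M\<close>, measurability into
      \<open>prob_algebra borel\<close> makes both values Borel probability measures.\<close>
    have Q0: "prob_space (Q0 \<omega>)" "sets (Q0 \<omega>) = sets borel"
      and Q: "prob_space (Q \<omega>)" "sets (Q \<omega>) = sets borel"
      using measurable_space[OF Q0_meas elim(1)] measurable_space[OF Q_meas elim(1)]
      by (auto simp: space_prob_algebra)
    have chain: "prob_space (measure_chain Q0 W \<theta> n \<omega>)"
        "sets (measure_chain Q0 W \<theta> n \<omega>) = sets borel" for n
      using measure_chain_prob[of Q0 \<omega> W \<theta> n] Q0 elim(2) by auto
    show ?case
      by (rule mixture_density_L1_convergence[OF elim(3) chain Q L_borel k_meas k_nonneg k_cont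
            k_le_h h_integrable])
  qed
qed

end
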